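(* Let $a=31207386885274502188173522132023665167365193670823768234185354856354918873864275$ and $M=36812852443922071184402498913076070503146229820861211558347078871354783744850778$. Then for every integer $x\equiv a \pmod M$ and every $n\in\{0,1,2,\ldots\}$, the number $x^2-F_{3n}/2$ has at least two distinct prime divisors.
   Context: $\{F_n\}_{n\geq 0}$ is the Fibonacci sequence: $F_0=0$, $F_1=1$, and $F_{n+1}=F_n+F_{n-1}$ for $n\geq 1$. (Note $F_{3n}$ is always even, so $F_{3n}/2$ is an integer.) *)

theory Defs
  imports "HOL-Number_Theory.Number_Theory"
begin

(* The integer division in "int (fib (3 * n)) div 2" is exact. *)
lemma even_fib_3n: "even (fib (3 * n))"
  by (induction n) (simp_all add: numeral_3_eq_3)

end

theory Submission
  imports Defs
begin

text \<open>The numbers \<open>g n = F(3n)/2\<close> satisfy \<open>g (n + 2) = 4 g (n + 1) + g n\<close> and are periodic modulo every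
  prime divisor of the modulus of the progression, with periods dividing 630. The residues modulo
  630 are covered by 50 classes, each with two such primes p, q and an even exponent h: for n in
  the class, \<open>N = x\<^sup>2 - g n\<close> is divisible by p, and \<open>p ^ h \<equiv> 1\<close> but \<open>N ^ h \<noteq> 1\<close> modulo q. If p were
  the only prime divisor of N, then \<open>N = \<plusminus>p ^ e\<close> and \<open>N ^ h = (p ^ h) ^ e \<equiv> 1\<close> modulo q.\<close>

section \<open>Halved Fibonacci numbers: recurrence, addition formula, periods\<close>

definition half_fib :: "nat \<Rightarrow> int" where
  "half_fib n = int (fib (3 * n)) div 2"

lemma half_fib_0 [simp]: "half_fib 0 = 0"
  by (simp add: half_fib_def)

lemma half_fib_1 [simp]: "half_fib (Suc 0) = 1"
  by (simp add: half_fib_def numeral_3_eq_3)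

lemma half_fib_rec: "half_fib (Suc (Suc n)) = 4 * half_fib (Suc n) + half_fib n"
proof -
  have double: "int (fib (3 * k)) = 2 * half_fib k" for k
    using even_fib_3n[of k] by (simp add: half_fib_def)
  \<comment> \<open>The Fibonacci recurrence with step 3: the coefficient 4 is the Lucas number
    L(3), and the sign is plus because 3 is odd.\<close>
  have "fib (Suc (Suc (Suc (Suc (Suc (Suc k)))))) = 4 * fib (Suc (Suc (Suc k))) + fib k" for k
    by simp
  from this[of "3 * n"] have "fib (3 * Suc (Suc n)) = 4 * fib (3 * Suc n) + fib (3 * n)"
    by (simp only: mult_Suc_right numeral_3_eq_3 add_Suc add_0)
  then have "int (fib (3 * Suc (Suc n))) = 4 * int (fib (3 * Suc n)) + int (fib (3 * n))"
    by simp
  then show ?thesis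
    unfolding double by simp
qed

text \<open>For fixed m both sides satisfy the recurrence in n, so n = 0 and n = 1 suffice;
  \<open>fib.induct\<close> supplies this two-step induction.\<close>

lemma half_fib_add:
  "half_fib (Suc (m + n)) = half_fib (Suc m) * half_fib (Suc n) + half_fib m * half_fib n"
  by (induction n rule: fib.induct) (simp_all add: half_fib_rec algebra_simps)

lemma half_fib_Suc_double:
  "half_fib (Suc (2 * n)) = half_fib n * half_fib n + half_fib (Suc n) * half_fib (Suc n)"
  using half_fib_add[of n n] by (simp add: mult_2)

text \<open>For positive n the addition formula yields the factor
  \<open>half_fib (n + 1) + half_fib (n - 1)\<close>. Eliminating the predecessor by the recurrence
  makes the pair at n, n + 1 determine the pair at 2n, 2n + 1.\<close>

lemma half_fib_double: "half_fib (2 * n) = half_fib n * (2 * half_fib (Suc n) - 4 * half_fib n)"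
proof (cases n)
  case (Suc k)
  then have "2 * n = Suc (k + n)"
    by simp
  then have "half_fib (2 * n) = half_fib (Suc k) * half_fib (Suc n) + half_fib k * half_fib n"
    by (simp only: half_fib_add)
  then show ?thesis
    by (simp add: Suc half_fib_rec algebra_simps)
qed simp

text \<open>By hypothesis the starting pair 0, 1 recurs at m; the addition formula carries this to
  every n.\<close>

lemma half_fib_periodic:
  assumes "[half_fib m = 0] (mod q)" "[half_fib (Suc m) = 1] (mod q)"
  shows "[half_fib (n + m) = half_fib n] (mod q)"
proof (cases n)
  case (Suc k)
  have "[half_fib (Suc k) * half_fib (Suc m) + half_fib k * half_fib m =
      half_fib (Suc k) * 1 + half_fib k * 0] (mod q)"
    using assms by (intro cong_add cong_mult cong_refl)
  then show ?thesis
    using Suc half_fib_add[of k m] by simp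
qed (use assms in simp)

lemma half_fib_cong_mod:
  assumes "[half_fib m = 0] (mod q)" "[half_fib (Suc m) = 1] (mod q)"
  shows "[half_fib n = half_fib (n mod m)] (mod q)"
proof -
  have "[half_fib (r + k * m) = half_fib r] (mod q)" for r k
  proof (induction k)
    case (Suc k)
    then show ?case
      using half_fib_periodic[OF assms, of "r + k * m"] cong_trans
      by (fastforce simp: algebra_simps)
  qed simp
  then show ?thesis
    by (metis mod_div_decomp add.commute)
qed

section \<open>Fast doubling modulo q\<close>

fun double_pair :: "int \<Rightarrow> int \<times> int \<Rightarrow> int \<times> int" where
  "double_pair q (u, v) = (u * (2 * v - 4 * u) mod q, (u * u + v * v) mod q)"

fun step_pair :: "int \<Rightarrow> int \<times> int \<Rightarrow> int \<times> int" where
  "step_pair q (u, v) = (v, (4 * v + u) mod q)"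

text \<open>Halving an integer index takes logarithmically many steps on binary numerals, which
  keeps the later evaluation short.\<close>

function half_fib_mod :: "int \<Rightarrow> int \<Rightarrow> int \<times> int" where
  "half_fib_mod q n =
    (if n \<le> 0 then (0, 1)
     else if n mod 2 = 0 then double_pair q (half_fib_mod q (n div 2))
     else step_pair q (double_pair q (half_fib_mod q (n div 2))))"
  by auto
termination by (relation "measure (\<lambda>(q, n). nat n)") auto

declare half_fib_mod.simps [simp del]

lemma double_pair_half_fib:
  "double_pair q (half_fib n mod q, half_fib (Suc n) mod q) =
    (half_fib (2 * n) mod q, half_fib (Suc (2 * n)) mod q)"
  unfolding half_fib_double half_fib_Suc_double double_pair.simps
  by (auto simp flip: cong_def intro!: cong_add cong_mult cong_diff)

lemma step_pair_half_fib:
  "step_pair q (half_fib n mod q, half_fib (Suc n) mod q) =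
    (half_fib (Suc n) mod q, half_fib (Suc (Suc n)) mod q)"
  unfolding half_fib_rec step_pair.simps
  by (auto simp flip: cong_def intro!: cong_add cong_mult)

lemma half_fib_mod_eq:
  assumes "q > 1"
  shows "half_fib_mod q n = (half_fib (nat n) mod q, half_fib (Suc (nat n)) mod q)"
proof (induction "nat n" arbitrary: n rule: less_induct)
  case less
  show ?case
  proof (cases "n \<le> 0")
    case True
    then show ?thesis
      using assms by (simp add: half_fib_mod.simps)
  next
    case False
    define k where "k = n div 2"
    have IH: "half_fib_mod q k = (half_fib (nat k) mod q, half_fib (Suc (nat k)) mod q)"
      using False by (intro less) (simp add: k_def)
    show ?thesis
    proof (cases "n mod 2 = 0")
      case True
      then have "n = 2 * k"
        by (auto simp: k_def)
      then have "nat n = 2 * nat k"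
        using False by linarith
      then show ?thesis
        using False True IH by (simp add: half_fib_mod.simps[of q n] double_pair_half_fib flip: k_def del: double_pair.simps)
    next
      case odd: False
      then have "n = 2 * k + 1"
        unfolding k_def by presburger
      then have "nat n = Suc (2 * nat k)"
        using False by linarith
      then show ?thesis
        using False odd IH
        by (simp add: half_fib_mod.simps[of q n] double_pair_half_fib step_pair_half_fib flip: k_def
            del: double_pair.simps step_pair.simps)
    qed
  qed
qed

section \<open>Modular exponentiation by repeated squaring\<close>

function power_mod :: "int \<Rightarrow> int \<Rightarrow> int \<Rightarrow> int" where
  "power_mod q b e =
    (if e \<le> 0 then 1
     else if e mod 2 = 0 then power_mod q (b * b mod q) (e div 2)
     else b * power_mod q (b * b mod q) (e div 2) mod q)"
  by auto
termination by (relation "measure (\<lambda>(q, b, e). nat e)") auto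

declare power_mod.simps [simp del]

lemma power_mod_eq:
  assumes "q > 1"
  shows "power_mod q b e = b ^ nat e mod q"
proof (induction "nat e" arbitrary: b e rule: less_induct)
  case less
  show ?case
  proof (cases "e \<le> 0")
    case True
    then show ?thesis
      using assms by (simp add: power_mod.simps)
  next
    case False
    define k where "k = e div 2"
    \<comment> \<open>The fact \<open>power_mod\<close> used here is the library rule that drops the
      inner reduction modulo q, not the function being verified.\<close>
    have IH: "power_mod q (b * b mod q) k = (b * b) ^ nat k mod q"
      using less[of k "b * b mod q"] False by (simp add: k_def power_mod)
    show ?thesis
    proof (cases "e mod 2 = 0")
      case True
      then have "e = 2 * k"
        by (auto simp: k_def)
      then have "nat e = 2 * nat k"
        using False by linarith
      then show ?thesis
        using False True IH
        by (simp add: power_mod.simps[of q b e] power_mult power2_eq_square flip: k_def)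
    next
      case odd: False
      then have "e = 2 * k + 1"
        unfolding k_def by presburger
      then have "nat e = Suc (2 * nat k)"
        using False by linarith
      then show ?thesis
        using False odd IH
        by (simp add: power_mod.simps[of q b e] power_mult power2_eq_square mod_simps flip: k_def)
    qed
  qed
qed

section \<open>Primality by trial division\<close>

function no_divisor_from :: "int \<Rightarrow> int \<Rightarrow> bool" where
  "no_divisor_from d p =
    (if d * d > p \<or> d \<le> 1 then True
     else if p mod d = 0 then False
     else no_divisor_from (d + 1) p)"
  by auto
termination
proof (relation "measure (\<lambda>(d, p). nat (p - d))", goal_cases)
  case (2 d p)
  \<comment> \<open>Excluding \<open>d \<le> 1\<close> gives d < d * d, hence d < p, so the measure
    p - d decreases.\<close>
  then have "d * 1 < d * d" "d * d \<le> p"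
    by (auto simp del: mult_1_right)
  then show ?case
    by auto
qed simp

declare no_divisor_from.simps [simp del]

lemma no_divisor_from_dvd:
  "no_divisor_from d p \<Longrightarrow> 1 < d \<Longrightarrow> d \<le> k \<Longrightarrow> k * k \<le> p \<Longrightarrow> \<not> k dvd p"
proof (induction d p rule: no_divisor_from.induct)
  case (1 d p)
  \<comment> \<open>The search cannot stop before it reaches k.\<close>
  have "d * d \<le> k * k"
    using "1.prems" by (intro mult_mono) auto
  then have "\<not> d * d > p"
    using "1.prems" by auto
  then have "p mod d \<noteq> 0 \<and> no_divisor_from (d + 1) p"
    using "1.prems" by (auto simp: no_divisor_from.simps[of d p] split: if_splits)
  moreover have "d + 1 \<le> k" if "k \<noteq> d"
    using that "1.prems" by auto
  ultimately show ?case
    using "1.IH" "1.prems" \<open>\<not> d * d > p\<close> by (cases "k = d") (auto simp: dvd_eq_mod_eq_0)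
qed

text \<open>Trial division is affordable: the largest prime to be tested is 912871, so there are
  fewer than 1000 trial divisors.\<close>

lemma prime_if_no_divisor:
  fixes p :: int
  assumes "p > 1" "no_divisor_from 2 p"
  shows "prime p"
proof -
  have "d = 1" if "d dvd nat p" "d\<^sup>2 \<le> nat p" for d
  proof (rule ccontr)
    assume "d \<noteq> 1"
    moreover have "d \<noteq> 0"
      using dvd_pos_nat[OF _ that(1)] assms(1) by simp
    moreover have "int d dvd int (nat p)"
      using that(1) by (simp only: int_dvd_int_iff)
    then have "int d dvd p"
      using assms(1) by simp
    moreover have "int d * int d \<le> p"
      using that(2) assms(1) by (simp add: power2_eq_square le_nat_iff)
    ultimately show False
      using no_divisor_from_dvd[OF assms(2), of "int d"] by auto
  qed
  moreover have "nat p \<noteq> 1"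
    using assms(1) by simp
  ultimately have "prime (nat p)"
    unfolding prime_divisor_sqrt by blast
  then show ?thesis
    unfolding prime_int_nat_transfer[of p] using assms(1) by simp
qed

section \<open>Criterion for a second prime divisor\<close>

lemma two_prime_divisors:
  fixes N p q :: int
  assumes "prime p" "p dvd N" "even h" "[p ^ h = 1] (mod q)" "\<not> [N ^ h = 1] (mod q)"
  shows "\<exists>p1 p2 :: int. prime p1 \<and> prime p2 \<and> p1 \<noteq> p2 \<and> p1 dvd N \<and> p2 dvd N"
proof (cases "N = 0")
  case True
  \<comment> \<open>The hypotheses do not exclude N = 0, which every prime divides.\<close>
  have "prime (2::int)" "prime (3::int)"
    by simp_all
  then show ?thesis
    using True by (intro exI[of _ 2] exI[of _ 3]) simp
next
  case False
  have "\<not> is_unit p"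
    using assms(1) by (auto dest: not_prime_unit)
  \<comment> \<open>Any prime divisor of the cofactor y differs from p, so only y = 1 and y = -1
    have to be excluded.\<close>
  then obtain y where y: "N = p ^ multiplicity p N * y" "\<not> p dvd y"
    using multiplicity_decompose'[OF False] by (metis mult.commute)
  have "\<not> is_unit y"
  proof
    assume "is_unit y"
    then have "y = 1 \<or> y = -1"
      by (auto simp: zdvd1_eq)
    \<comment> \<open>The even exponent absorbs the sign, so negative N need no separate
      argument.\<close>
    then have "y ^ h = 1"
      using assms(3) by auto
    then have "N ^ h = (p ^ h) ^ multiplicity p N"
      by (subst y(1)) (simp add: power_mult_distrib power_mult[symmetric] mult.commute)
    also have "[\<dots> = 1 ^ multiplicity p N] (mod q)"
      using assms(4) by (rule cong_pow)
    finally show False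
      using assms(5) by simp
  qed
  moreover have "y \<noteq> 0"
    using y(2) by auto
  ultimately obtain r where r: "prime r" "r dvd y"
    using prime_divisor_exists by blast
  then have "r dvd N"
    by (metis y(1) dvd_mult)
  moreover have "r \<noteq> p"
    using r(2) y(2) by auto
  ultimately show ?thesis
    using assms(1,2) r(1) by blast
qed

section \<open>The progression, its primes and the covering\<close>

definition progression_start :: int where
  "progression_start = 31207386885274502188173522132023665167365193670823768234185354856354918873864275"

text \<open>This is the product of the 25 primes in \<open>prime_table\<close>; the Chinese
  remainder theorem thus turns the residues listed there into one class.\<close>

definition progression_modulus :: int where
  "progression_modulus = 36812852443922071184402498913076070503146229820861211558347078871354783744850778"

text \<open>The entry (p, (s, k)) records that s is the residue of the progression modulo p, and that
  k is a period of \<^const>\<open>half_fib\<close> modulo p.\<close>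

definition prime_table :: "(int \<times> int \<times> int) list" where
  "prime_table =
   [(2, 1, 2), (11, 4, 10), (19, 2, 6), (29, 5, 14), (31, 14, 10), (71, 30, 70),
    (181, 76, 30), (211, 94, 14), (271, 85, 90), (379, 72, 126), (541, 156, 30),
    (631, 205, 210), (811, 292, 90), (911, 257, 70), (1009, 501, 42), (5779, 0, 18),
    (17011, 497, 630), (21211, 7199, 70), (31249, 10727, 42), (42391, 9054, 90),
    (69931, 19928, 630), (85429, 40368, 126), (119611, 13909, 90), (767131, 2, 70),
    (912871, 80065, 126)]"

fun valid_prime :: "int \<times> int \<times> int \<Rightarrow> bool" where
  "valid_prime (p, s, k) \<longleftrightarrow> 1 < p \<and> 0 < k \<and> no_divisor_from 2 p \<and> progression_modulus mod p = 0 \<and>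
    progression_start mod p = s \<and> half_fib_mod p k = (0, 1)"

text \<open>The entry (r, m, p, q, h) covers the class r modulo m.\<close>

definition covering :: "(int \<times> int \<times> int \<times> int \<times> int) list" where
  "covering =
   [(1, 10, 2, 31, 10), (3, 10, 2, 31, 10), (7, 10, 2, 31, 10), (9, 10, 2, 31, 10),
    (2, 18, 19, 5779, 642), (8, 18, 19, 5779, 642), (14, 18, 19, 5779, 642),
    (4, 30, 31, 181, 20), (6, 30, 11, 19, 6), (16, 30, 11, 181, 90), (24, 30, 31, 19, 6),
    (12, 42, 29, 31249, 15624), (18, 42, 31249, 29, 14), (22, 42, 211, 31249, 1736),
    (24, 42, 1009, 29, 14), (36, 42, 211, 31249, 1736), (40, 42, 29, 1009, 504),
    (2, 70, 767131, 29, 14), (5, 70, 2, 911, 182), (15, 70, 2, 911, 182),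
    (28, 70, 21211, 29, 4), (35, 70, 2, 767131, 153426), (48, 70, 911, 29, 4),
    (55, 70, 2, 911, 182), (58, 70, 71, 211, 10), (65, 70, 2, 911, 182),
    (0, 90, 5779, 271, 54), (10, 90, 541, 271, 2), (12, 90, 119611, 271, 10),
    (22, 90, 181, 271, 30), (30, 90, 42391, 271, 54), (40, 90, 541, 271, 2),
    (52, 90, 181, 271, 30), (58, 90, 271, 31, 10), (60, 90, 811, 31, 6),
    (70, 90, 541, 271, 2), (82, 90, 181, 42391, 4710), (0, 126, 5779, 379, 14),
    (10, 126, 379, 19, 2), (46, 126, 912871, 29, 14), (88, 126, 85429, 29, 14),
    (25, 210, 2, 631, 90), (45, 210, 2, 631, 90), (95, 210, 2, 631, 90),
    (115, 210, 2, 631, 90), (132, 210, 631, 1009, 28), (165, 210, 2, 631, 90),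
    (185, 210, 2, 631, 90), (42, 630, 69931, 29, 4), (178, 630, 17011, 29, 4)]"

text \<open>Since m is a common multiple of the periods modulo p and q, the residues of N modulo
  both depend only on r. The number h is an even multiple of the order of p modulo q: for p = 2 and
  q = 31 the order is 5 and h is 10.\<close>

fun valid_class :: "int \<times> int \<times> int \<times> int \<times> int \<Rightarrow> bool" where
  "valid_class (r, m, p, q, h) \<longleftrightarrow>
    (case map_of prime_table p of None \<Rightarrow> False | Some (s, k) \<Rightarrow>
     (case map_of prime_table q of None \<Rightarrow> False | Some (t, l) \<Rightarrow>
      0 \<le> r \<and> 0 < m \<and> 630 mod m = 0 \<and> m mod k = 0 \<and> m mod l = 0 \<and> h mod 2 = 0 \<and>
      (s * s - fst (half_fib_mod p r)) mod p = 0 \<and>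
      power_mod q p h = 1 \<and> power_mod q (t * t - fst (half_fib_mod q r)) h \<noteq> 1))"

text \<open>With a disjunction in place of the conditional, \<open>code_simp\<close> would not stop at the first
  class that contains n.\<close>

primrec covered_by :: "(int \<times> int \<times> int \<times> int \<times> int) list \<Rightarrow> int \<Rightarrow> bool" where
  "covered_by [] n = False"
| "covered_by (c # cs) n = (if n mod fst (snd c) = fst c then True else covered_by cs n)"

section \<open>Verification of the data by evaluation\<close>

lemma valid_prime_table: "list_all valid_prime prime_table"
  by code_simp

lemma valid_covering: "list_all valid_class covering"
  by code_simp

lemma covering_covers: "list_all (covered_by covering) [0..629]"
  by code_simp

text \<open>Since p divides the modulus, x inherits the residue s of the progression; the value (0,
  1) of \<open>half_fib_mod p k\<close> is the periodicity hypothesis of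
  \<open>half_fib_cong_mod\<close>.\<close>

lemma prime_table_lookup:
  assumes "map_of prime_table p = Some (s, k)" "[x = progression_start] (mod progression_modulus)"
  shows "prime p" "p > 1" "[x = s] (mod p)" "k > 0" "[half_fib n = half_fib (n mod nat k)] (mod p)"
proof -
  have valid: "valid_prime (p, s, k)"
    using map_of_SomeD[OF assms(1)] valid_prime_table unfolding list_all_iff by blast
  then show p: "prime p" "p > 1" "k > 0"
    by (simp_all add: prime_if_no_divisor)
  have "p dvd progression_modulus"
    using valid by (simp add: dvd_eq_mod_eq_0)
  then have "[x = progression_start] (mod p)"
    using assms(2) by (rule cong_dvd_modulus[rotated])
  then show "[x = s] (mod p)"
    using valid by (auto simp: cong_def)
  show "[half_fib n = half_fib (n mod nat k)] (mod p)"
    using valid p by (intro half_fib_cong_mod) (auto simp: half_fib_mod_eq cong_def)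
qed

lemma covered_byD: "covered_by cs n \<Longrightarrow> \<exists>(r, m, c) \<in> set cs. n mod m = r"
  by (induction cs) (fastforce split: if_splits)+

theorem theorem1p3:
  fixes x :: int and n :: nat
  assumes "[x = 31207386885274502188173522132023665167365193670823768234185354856354918873864275]
    (mod 36812852443922071184402498913076070503146229820861211558347078871354783744850778)"
  shows "\<exists>p q :: int. prime p \<and> prime q \<and> p \<noteq> q \<and>
    p dvd x\<^sup>2 - int (fib (3 * n)) div 2 \<and> q dvd x\<^sup>2 - int (fib (3 * n)) div 2"
proof -
  define N where "N = x\<^sup>2 - half_fib n"
  have x: "[x = progression_start] (mod progression_modulus)"
    using assms unfolding progression_start_def progression_modulus_def .
  have "covered_by covering (int n mod 630)"
    using covering_covers unfolding list_all_iff set_upto by (rule bspec) simp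
  then obtain r m p q h where rm: "(r, m, p, q, h) \<in> set covering" "int n mod 630 mod m = r"
    by (auto dest!: covered_byD)
  then have valid: "valid_class (r, m, p, q, h)"
    using valid_covering unfolding list_all_iff by blast
  then obtain s k t l where
    p: "map_of prime_table p = Some (s, k)" and q: "map_of prime_table q = Some (t, l)"
    by (auto split: option.splits)
  note p' = prime_table_lookup[OF p x] and q' = prime_table_lookup[OF q x]
  have m: "0 < m" "m dvd 630" "k dvd m" "l dvd m" "even h"
    and p_cong: "[s * s = fst (half_fib_mod p r)] (mod p)"
    and q_powers: "power_mod q p h = 1" "power_mod q (t * t - fst (half_fib_mod q r)) h \<noteq> 1"
    using valid p q by (simp_all add: cong_iff_dvd_diff mod_eq_0_iff_dvd)
  \<comment> \<open>As m divides 630, the prior reduction modulo 630 preserves the class modulo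
    m.\<close>
  have r_eq: "int n mod m = r"
    using rm(2) m(2) by (simp add: mod_mod_cancel)
  then have r: "nat r = n mod nat m"
    unfolding r_eq[symmetric] using m(1) by (simp add: nat_mod_distrib)
  \<comment> \<open>Both periods divide m, so n and its representative r leave the same remainder
    modulo each period.\<close>
  have reduce: "[half_fib n = half_fib (nat r)] (mod p)" "[half_fib n = half_fib (nat r)] (mod q)"
  proof -
    have "n mod nat m mod nat j = n mod nat j" if "j dvd m" "0 < j" for j
      using that m(1) by (intro mod_mod_cancel) (simp add: nat_dvd_iff)
    then show "[half_fib n = half_fib (nat r)] (mod p)" "[half_fib n = half_fib (nat r)] (mod q)"
      using p'(5)[of n] p'(5)[of "nat r"] q'(5)[of n] q'(5)[of "nat r"] p'(4) q'(4) m(3,4)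
      by (simp_all add: r cong_def)
  qed
  have "[N = s * s - half_fib (nat r)] (mod p)"
    unfolding N_def power2_eq_square by (intro cong_diff cong_mult p'(3) reduce)
  also have "[s * s - half_fib (nat r) = 0] (mod p)"
    using p_cong p'(2) by (simp add: half_fib_mod_eq cong_def mod_eq_0_iff_dvd mod_eq_dvd_iff)
  finally have "p dvd N"
    by (simp add: cong_0_iff)
  moreover have "[p ^ nat h = 1] (mod q)"
    using q_powers(1) q'(2) by (simp add: power_mod_eq cong_def)
  moreover have "\<not> [N ^ nat h = 1] (mod q)"
  proof -
    have "[N = t * t - half_fib (nat r)] (mod q)"
      unfolding N_def power2_eq_square by (intro cong_diff cong_mult q'(3) reduce)
    also have "[t * t - half_fib (nat r) = t * t - fst (half_fib_mod q r)] (mod q)"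
      using q'(2) by (simp add: half_fib_mod_eq cong_def mod_simps)
    finally have "[N ^ nat h = (t * t - fst (half_fib_mod q r)) ^ nat h] (mod q)"
      by (rule cong_pow)
    then show ?thesis
      using q_powers(2) q'(2) by (simp add: power_mod_eq cong_def)
  qed
  \<comment> \<open>For negative h the value \<open>nat h\<close> is 0, which is even as
    well.\<close>
  moreover have "even (nat h)"
    using m(5) by (cases "0 \<le> h") (simp_all add: even_nat_iff)
  ultimately show ?thesis
    using two_prime_divisors[OF p'(1)] by (simp add: N_def half_fib_def)
qed

end
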